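(* Let $n\geq3$. Then $|\mathcal{DPC}_n|=n2^{n+1}-\frac{(-1)^n+5}{4}n^2-2n+1$.
   Context: For $n\geq3$, $C_n$ is the cycle graph with vertex set $\{1,\ldots,n\}$ and edges $\{i,i+1\}$ ($1\leq i\leq n-1$) and $\{1,n\}$; $\mathrm{d}(x,y)=\min\{|x-y|,n-|x-y|\}$ is the geodesic distance in $C_n$. $\mathcal{DPC}_n$ is the monoid, under composition, of all partial isometries of $C_n$, i.e. of all partial transformations $\alpha$ of $\{1,\ldots,n\}$ (including the empty one) such that $\mathrm{d}(x\alpha,y\alpha)=\mathrm{d}(x,y)$ for all $x,y\in\mathrm{Dom}(\alpha)$. *)

theory Defs
  imports Complex_Main "HOL-Algebra.Coset"
begin

text \<open>An undirected graph is given by its set of edges, each edge being the set of its endpoints.\<close>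

definition adjacency :: "'a set set \<Rightarrow> 'a rel" where
  "adjacency E = {(x, y). {x, y} \<in> E}"

text \<open>The length of a shortest walk. The value is meaningful only for connected vertices, which
  is no restriction for cycle graphs.\<close>

definition geodesic_dist :: "'a set set \<Rightarrow> 'a \<Rightarrow> 'a \<Rightarrow> nat" where
  "geodesic_dist E x y = (LEAST k. (x, y) \<in> adjacency E ^^ k)"

definition cycle_edges :: "nat \<Rightarrow> nat set set" where
  "cycle_edges n = {{i, i + 1} |i. 1 \<le> i \<and> i \<le> n - 1} \<union> {{1, n}}"

definition partial_isometry :: "'a set \<Rightarrow> 'a set set \<Rightarrow> ('a \<rightharpoonup> 'a) \<Rightarrow> bool" where
  "partial_isometry V E \<alpha> \<longleftrightarrow> dom \<alpha> \<subseteq> V \<and> ran \<alpha> \<subseteq> V \<and>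
     (\<forall>x\<in>dom \<alpha>. \<forall>y\<in>dom \<alpha>.
        geodesic_dist E (the (\<alpha> x)) (the (\<alpha> y)) = geodesic_dist E x y)"

text \<open>Transformations act on the right, so the product of \<open>\<alpha>\<close> and \<open>\<beta>\<close> applies \<open>\<alpha>\<close> first.\<close>

definition DPC :: "nat \<Rightarrow> (nat \<rightharpoonup> nat) monoid" where
  "DPC n = \<lparr>carrier = {\<alpha>. partial_isometry {1..n} (cycle_edges n) \<alpha>},
            mult = (\<lambda>\<alpha> \<beta>. \<beta> \<circ>\<^sub>m \<alpha>), one = Some |` {1..n}\<rparr>"

lemma monoid_DPC: "monoid (DPC n)"
proof
  fix \<alpha> \<beta> assume a: "\<alpha> \<in> carrier (DPC n)" and b: "\<beta> \<in> carrier (DPC n)"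
  have "dom (\<beta> \<circ>\<^sub>m \<alpha>) \<subseteq> dom \<alpha>" "ran (\<beta> \<circ>\<^sub>m \<alpha>) \<subseteq> ran \<beta>"
    by (auto simp: map_comp_Some_iff ran_def)
  moreover have "dom \<alpha> \<subseteq> {1..n}" "ran \<beta> \<subseteq> {1..n}"
    using a b by (simp_all add: DPC_def partial_isometry_def)
  ultimately have "dom (\<beta> \<circ>\<^sub>m \<alpha>) \<subseteq> {1..n}" "ran (\<beta> \<circ>\<^sub>m \<alpha>) \<subseteq> {1..n}"
    by blast+
  moreover have "geodesic_dist (cycle_edges n) (the ((\<beta> \<circ>\<^sub>m \<alpha>) x)) (the ((\<beta> \<circ>\<^sub>m \<alpha>) y))
      = geodesic_dist (cycle_edges n) x y"
    if xy: "x \<in> dom (\<beta> \<circ>\<^sub>m \<alpha>)" "y \<in> dom (\<beta> \<circ>\<^sub>m \<alpha>)" for x y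
  proof -
    obtain x' x'' y' y'' where h: "\<alpha> x = Some x'" "\<beta> x' = Some x''" "\<alpha> y = Some y'" "\<beta> y' = Some y''"
      using xy by (auto simp: map_comp_Some_iff)
    have "geodesic_dist (cycle_edges n) x' y' = geodesic_dist (cycle_edges n) x y"
      using a h by (force simp: DPC_def partial_isometry_def)
    moreover have "geodesic_dist (cycle_edges n) x'' y'' = geodesic_dist (cycle_edges n) x' y'"
      using b h by (force simp: DPC_def partial_isometry_def)
    ultimately show ?thesis using h by simp
  qed
  ultimately show "\<alpha> \<otimes>\<^bsub>DPC n\<^esub> \<beta> \<in> carrier (DPC n)"
    by (auto simp: DPC_def partial_isometry_def)
next
  show "\<one>\<^bsub>DPC n\<^esub> \<in> carrier (DPC n)"
    by (auto simp: DPC_def partial_isometry_def restrict_map_def ran_def split: if_splits)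
next
  fix \<alpha> assume a: "\<alpha> \<in> carrier (DPC n)"
  then have d: "dom \<alpha> \<subseteq> {1..n}" and r: "ran \<alpha> \<subseteq> {1..n}"
    by (simp_all add: DPC_def partial_isometry_def)
  have "(\<alpha> \<circ>\<^sub>m (Some |` {1..n})) x = \<alpha> x" for x
    using d by (cases "\<alpha> x") (auto simp: map_comp_def restrict_map_def)
  then show "\<one>\<^bsub>DPC n\<^esub> \<otimes>\<^bsub>DPC n\<^esub> \<alpha> = \<alpha>"
    by (simp add: DPC_def fun_eq_iff)
  have "((Some |` {1..n}) \<circ>\<^sub>m \<alpha>) x = \<alpha> x" for x
  proof (cases "\<alpha> x")
    case (Some y)
    then have "y \<in> {1..n}" using r by (auto intro: ranI)
    with Some show ?thesis by (simp add: map_comp_def)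
  qed simp
  then show "\<alpha> \<otimes>\<^bsub>DPC n\<^esub> \<one>\<^bsub>DPC n\<^esub> = \<alpha>"
    by (simp add: DPC_def fun_eq_iff)
qed (auto simp: DPC_def map_comp_def fun_eq_iff split: option.splits)

lemma sym_adjacency: "sym (adjacency E)"
  by (auto simp: sym_def adjacency_def insert_commute)

lemma sym_relpow_adjacency: "(x, y) \<in> adjacency E ^^ k \<Longrightarrow> (y, x) \<in> adjacency E ^^ k"
proof (induction k arbitrary: y)
  case (Suc k)
  then obtain z where "(x, z) \<in> adjacency E ^^ k" "(z, y) \<in> adjacency E" by auto
  with Suc.IH sym_adjacency[of E] show ?case
    by (metis relpow_Suc_I2 symD)
qed simp

lemma cycle_walk_up: "(x, x + k) \<in> adjacency (cycle_edges n) ^^ k" if "1 \<le> x" "x + k \<le> n"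
  using that
proof (induction k)
  case (Suc k)
  then have "(x + k, x + Suc k) \<in> adjacency (cycle_edges n)"
    by (fastforce simp: adjacency_def cycle_edges_def)
  with Suc show ?case by (auto intro: relpow_Suc_I)
qed simp

lemma geodesic_dist_cycle:
  assumes "n \<ge> 3" "x \<in> {1..n}" "y \<in> {1..n}"
  shows "int (geodesic_dist (cycle_edges n) x y)
    = min \<bar>int x - int y\<bar> (int n - \<bar>int x - int y\<bar>)" (is "_ = ?d y")
proof -
  let ?A = "adjacency (cycle_edges n)"
  have w: "(u, v) \<in> ?A ^^ (v - u)" "(u, v) \<in> ?A ^^ (n - (v - u))"
    if "1 \<le> u" "u \<le> v" "v \<le> n" for u v
  proof -
    show "(u, v) \<in> ?A ^^ (v - u)" using cycle_walk_up[of u "v - u" n] that by simp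
    have "(v, n) \<in> ?A ^^ (n - v)" using cycle_walk_up[of v "n - v" n] that by simp
    moreover have "(n, 1) \<in> ?A" by (auto simp: adjacency_def cycle_edges_def insert_commute)
    moreover have "(1, u) \<in> ?A ^^ (u - 1)" using cycle_walk_up[of 1 "u - 1" n] that by simp
    ultimately have "(v, u) \<in> ?A ^^ (Suc (n - v) + (u - 1))"
      by (metis relpow_Suc_I relpow_trans)
    moreover have "Suc (n - v) + (u - 1) = n - (v - u)" using that by simp
    ultimately show "(u, v) \<in> ?A ^^ (n - (v - u))" using sym_relpow_adjacency by metis
  qed
  have "(x, y) \<in> ?A ^^ nat \<bar>int x - int y\<bar>" "(x, y) \<in> ?A ^^ nat (int n - \<bar>int x - int y\<bar>)"
  proof -
    have "(x, y) \<in> ?A ^^ nat \<bar>int x - int y\<bar> \<and> (x, y) \<in> ?A ^^ nat (int n - \<bar>int x - int y\<bar>)"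
    proof (cases "x \<le> y")
      case True
      then have "nat \<bar>int x - int y\<bar> = y - x" "nat (int n - \<bar>int x - int y\<bar>) = n - (y - x)" 
        using assms by auto
      with w[of x y] True assms show ?thesis by simp
    next
      case False
      then have "nat \<bar>int x - int y\<bar> = x - y" "nat (int n - \<bar>int x - int y\<bar>) = n - (x - y)"
        using assms by auto
      with w[of y x] False assms show ?thesis by (simp add: sym_relpow_adjacency)
    qed
    then show "(x, y) \<in> ?A ^^ nat \<bar>int x - int y\<bar>"
      "(x, y) \<in> ?A ^^ nat (int n - \<bar>int x - int y\<bar>)" by auto
  qed
  then have walk: "(x, y) \<in> ?A ^^ nat (?d y)" by (simp add: min_def)
  have lower: "v \<in> {1..n} \<and> ?d v \<le> int k" if "(x, v) \<in> ?A ^^ k" for k v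
    using that
  proof (induction k arbitrary: v)
    case 0
    with assms show ?case by auto
  next
    case (Suc k)
    then obtain u where u: "(x, u) \<in> ?A ^^ k" "(u, v) \<in> ?A" by auto
    have "u \<in> {1..n}" "?d u \<le> int k" using Suc.IH[OF u(1)] by auto
    moreover have "v = u + 1 \<and> u + 1 \<le> n \<or> u = v + 1 \<and> 1 \<le> v \<or> u = 1 \<and> v = n \<or> u = n \<and> v = 1"
      using u(2) assms(1) by (auto simp: adjacency_def cycle_edges_def doubleton_eq_iff)
    ultimately show ?case using assms(1,2) by (auto simp: min_def abs_if split: if_splits)
  qed
  have "geodesic_dist (cycle_edges n) x y = nat (?d y)"
    unfolding geodesic_dist_def
    by (rule Least_equality[where P = "\<lambda>k. (x, y) \<in> ?A ^^ k"], rule walk) (use lower in fastforce)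
  then show ?thesis using assms by auto
qed

end

theory Submission
  imports Defs
begin

text \<open>A partial isometry \<open>\<alpha>\<close> with \<open>a\<close> in its domain satisfies \<open>x\<alpha> - a\<alpha> \<equiv> \<plusminus>(x - a) (mod n)\<close> for each
  \<open>x\<close> in the domain. Two points whose \<open>2(x - a)\<close> is nonzero modulo \<open>n\<close> cannot have opposite signs, so \<open>\<alpha>\<close> is
  the restriction of a dihedral map \<open>x \<mapsto> c \<plusminus> x\<close>. On a nonempty domain the \<open>2n\<close> dihedral maps have pairwise
  different restrictions, unless all differences of points of the domain have order at most 2, in
  which case the sign is immaterial and there are \<open>n\<close> restrictions. The exceptional domains are the
  \<open>n\<close> singletons and, for even \<open>n\<close>, the \<open>n/2\<close> antipodal pairs.\<close>

text \<open>The representative in \<open>{1..n}\<close>, rather than \<open>{0..<n}\<close>, of a residue class.\<close>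

definition cycle_rep :: "nat \<Rightarrow> int \<Rightarrow> nat" where
  "cycle_rep n z = nat ((z - 1) mod int n) + 1"

text \<open>The pair \<open>(c, s)\<close> encodes the map \<open>x -> c + s * x\<close> modulo n: a
  rotation for \<open>s = 1\<close>, a reflection for \<open>s = -1\<close>.\<close>

definition dihedral_restr :: "nat \<Rightarrow> nat set \<Rightarrow> int \<times> int \<Rightarrow> (nat \<rightharpoonup> nat)" where
  "dihedral_restr n A = (\<lambda>(c, s) x. if x \<in> A then Some (cycle_rep n (c + s * int x)) else None)"

definition isometries_on :: "nat \<Rightarrow> nat set \<Rightarrow> (nat \<rightharpoonup> nat) set" where
  "isometries_on n A = {\<alpha>. partial_isometry {1..n} (cycle_edges n) \<alpha> \<and> dom \<alpha> = A}"

definition degenerate :: "nat \<Rightarrow> nat set \<Rightarrow> bool" where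
  "degenerate n A \<longleftrightarrow> (\<forall>x\<in>A. \<forall>y\<in>A. int n dvd 2 * (int x - int y))"

section \<open>Residues modulo n, and distances as congruences\<close>

lemma cycle_rep_in: "n > 0 \<Longrightarrow> cycle_rep n z \<in> {1..n}"
  using pos_mod_bound[of "int n" "z - 1"] pos_mod_sign[of "int n" "z - 1"]
  by (simp add: cycle_rep_def nat_less_iff Suc_le_eq)

lemma cycle_rep_dvd: "n > 0 \<Longrightarrow> int n dvd int (cycle_rep n z) - z"
proof -
  assume "n > 0"
  then have "int (cycle_rep n z) - z = - ((z - 1) - (z - 1) mod int n)"
    by (simp add: cycle_rep_def)
  then show ?thesis by (simp add: minus_mod_eq_mult_div)
qed

lemma cycle_rep_eq_iff: "n > 0 \<Longrightarrow> cycle_rep n y = cycle_rep n z \<longleftrightarrow> int n dvd y - z"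
  by (simp add: cycle_rep_def nat_eq_iff mod_eq_dvd_iff)

lemma cycle_rep_of_nat: "x \<in> {1..n} \<Longrightarrow> cycle_rep n (int x) = x"
  by (auto simp: cycle_rep_def)

text \<open>Turns congruences into equations: sums and differences of two integers of modulus below
  n lie in this range.\<close>

lemma dvd_abs_less:
  assumes "int n dvd z" "\<bar>z\<bar> < 2 * int n"
  shows "z = 0 \<or> z = int n \<or> z = - int n"
proof -
  obtain k where k: "z = int n * k" using assms(1) by blast
  have "\<bar>k\<bar> < 2"
    using assms(2) unfolding k abs_mult by (simp add: mult.commute[of 2] mult_less_cancel_left)
  then have "k = 0 \<or> k = 1 \<or> k = -1" by linarith
  with k show ?thesis by auto
qed

text \<open>A distance in the cycle determines the difference of the two points modulo n up to sign,
  and nothing more.\<close>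

lemma geodesic_dist_cycle_eq_iff:
  assumes "n \<ge> 3" "x \<in> {1..n}" "y \<in> {1..n}" "u \<in> {1..n}" "v \<in> {1..n}"
  shows "geodesic_dist (cycle_edges n) u v = geodesic_dist (cycle_edges n) x y
    \<longleftrightarrow> int n dvd (int u - int v) - (int x - int y) \<or> int n dvd (int u - int v) + (int x - int y)"
    (is "?L \<longleftrightarrow> ?R")
proof -
  define D E where "D = int u - int v" and "E = int x - int y"
  have b: "\<bar>D\<bar> < int n" "\<bar>E\<bar> < int n" using assms by (auto simp: D_def E_def)
  have "?L \<longleftrightarrow> min \<bar>D\<bar> (int n - \<bar>D\<bar>) = min \<bar>E\<bar> (int n - \<bar>E\<bar>)"
    using geodesic_dist_cycle[OF assms(1,2,3)] geodesic_dist_cycle[OF assms(1,4,5)]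
    by (simp add: D_def E_def flip: of_nat_eq_iff[where 'a = int])
  \<comment> \<open>The function \<open>t -> min t (n - t)\<close> takes equal values only at t and
    n - t.\<close>
  also have "\<dots> \<longleftrightarrow> \<bar>D\<bar> = \<bar>E\<bar> \<or> \<bar>D\<bar> + \<bar>E\<bar> = int n" using b by linarith
  also have "\<dots> \<longleftrightarrow> D - E \<in> {0, int n, - int n} \<or> D + E \<in> {0, int n, - int n}" 
    using b by auto
  also have "\<dots> \<longleftrightarrow> int n dvd D - E \<or> int n dvd D + E"
    using dvd_abs_less[of n "D - E"] dvd_abs_less[of n "D + E"] b by auto
  finally show ?thesis by (simp add: D_def E_def)
qed

section \<open>Partial isometries as restrictions of dihedral maps\<close>

lemma dihedral_restr_isometry:
  assumes "n \<ge> 3" "A \<subseteq> {1..n}" "s = 1 \<or> s = -1"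
  shows "dihedral_restr n A (c, s) \<in> isometries_on n A"
proof -
  let ?r = "\<lambda>x. cycle_rep n (c + s * int x)"
  have dom: "dom (dihedral_restr n A (c, s)) = A"
    by (auto simp: dihedral_restr_def split: if_splits)
  have "geodesic_dist (cycle_edges n) (?r x) (?r y) = geodesic_dist (cycle_edges n) x y"
    if "x \<in> A" "y \<in> A" for x y
  proof -
    have "int n dvd (int (?r x) - (c + s * int x)) - (int (?r y) - (c + s * int y))"
      using assms(1) by (intro dvd_diff cycle_rep_dvd) auto
    then have "int n dvd (int (?r x) - int (?r y)) - s * (int x - int y)"
      by (simp add: algebra_simps)
    then show ?thesis
      using that assms cycle_rep_in[of n]
      by (subst geodesic_dist_cycle_eq_iff) (auto simp: algebra_simps)
  qed
  moreover have "ran (dihedral_restr n A (c, s)) \<subseteq> {1..n}"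
    using assms(1) cycle_rep_in[of n] by (auto simp: dihedral_restr_def ran_def split: if_splits)
  ultimately show ?thesis
    using assms(2) dom by (auto simp: isometries_on_def partial_isometry_def dihedral_restr_def)
qed

lemma isometry_is_dihedral_restr:
  assumes n: "n \<ge> 3" and A: "a \<in> A" and \<alpha>: "\<alpha> \<in> isometries_on n A"
  obtains c s where "c \<in> {0..<int n}" "s = 1 \<or> s = -1" "\<alpha> = dihedral_restr n A (c, s)"
proof -
  define f where "f x = the (\<alpha> x)" for x
  have dom: "dom \<alpha> = A" and sub: "A \<subseteq> {1..n}" and ran: "ran \<alpha> \<subseteq> {1..n}"
    and iso: "\<And>x y. x \<in> A \<Longrightarrow> y \<in> A \<Longrightarrow>
      geodesic_dist (cycle_edges n) (f x) (f y) = geodesic_dist (cycle_edges n) x y"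
    using \<alpha> by (auto simp: isometries_on_def partial_isometry_def f_def)
  have f: "\<alpha> x = Some (f x)" if "x \<in> A" for x
    using that dom by (auto simp: f_def)
  have fin: "f x \<in> {1..n}" if "x \<in> A" for x
    using f[OF that] ran by (auto intro: ranI)
  have pm: "int n dvd (int (f x) - int (f y)) - (int x - int y)
      \<or> int n dvd (int (f x) - int (f y)) + (int x - int y)"
    if "x \<in> A" "y \<in> A" for x y
    using iso[OF that] geodesic_dist_cycle_eq_iff[OF n, of x y "f x" "f y"] that sub fin by blast
  \<comment> \<open>Suppose b admits only the sign 1 and c admits -1. If the pair b, c had sign -1,
    adding congruences would give b the sign -1 as well; so it has sign 1, which forces 2(c - a) to
    vanish modulo n.\<close>
  have flip: "int n dvd 2 * (int c - int a)"
    if "b \<in> A" "c \<in> A" and b: "int n dvd (int (f b) - int (f a)) - (int b - int a)"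
      "\<not> int n dvd (int (f b) - int (f a)) + (int b - int a)"
      and c: "int n dvd (int (f c) - int (f a)) + (int c - int a)" for b c
    using pm[OF that(1,2)]
  proof
    assume "int n dvd (int (f b) - int (f c)) - (int b - int c)"
    from dvd_diff[OF dvd_add[OF this c] b(1)] show ?thesis by (simp add: algebra_simps)
  next
    assume "int n dvd (int (f b) - int (f c)) + (int b - int c)"
    from dvd_add[OF this c] b(2) show ?thesis by (simp add: algebra_simps)
  qed
  have "\<exists>s. (s = 1 \<or> s = -1) \<and>
    (\<forall>x\<in>A. int n dvd (int (f x) - int (f a)) - s * (int x - int a))"
  proof (cases "\<forall>x\<in>A. int n dvd (int (f x) - int (f a)) + (int x - int a)")
    case True
    then show ?thesis by (intro exI[of _ "-1"]) (auto simp: algebra_simps)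
  next
    case False
    then obtain b where bA: "b \<in> A"
      and b2: "\<not> int n dvd (int (f b) - int (f a)) + (int b - int a)" by blast
    then have b1: "int n dvd (int (f b) - int (f a)) - (int b - int a)" using pm A by blast
    \<comment> \<open>One point b that excludes the sign -1 settles the sign for all of
      \<open>A\<close>: wherever -1 holds, \<open>flip\<close> makes both signs equivalent.\<close>
    have "int n dvd (int (f x) - int (f a)) - (int x - int a)" if x: "x \<in> A" for x
      using pm[OF x A]
    proof
      assume h: "int n dvd (int (f x) - int (f a)) + (int x - int a)"
      from dvd_diff[OF h flip[OF bA x b1 b2 h]] show ?thesis by (simp add: algebra_simps)
    qed
    then show ?thesis by (intro exI[of _ 1]) auto
  qed
  then obtain s where s: "s = 1 \<or> s = -1"
    and fs: "\<And>x. x \<in> A \<Longrightarrow> int n dvd (int (f x) - int (f a)) - s * (int x - int a)" by blast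
  \<comment> \<open>The translation part is forced by the value at the base point a.\<close>
  define c where "c = (int (f a) - s * int a) mod int n"
  have c: "int n dvd (int (f a) - s * int a) - c"
    by (simp add: c_def minus_mod_eq_mult_div)
  have "\<alpha> x = dihedral_restr n A (c, s) x" for x
  proof (cases "x \<in> A")
    case True
    have "int n dvd int (f x) - (c + s * int x)"
      using dvd_add[OF fs[OF True] c] by (simp add: algebra_simps)
    then have "cycle_rep n (int (f x)) = cycle_rep n (c + s * int x)"
      using n by (simp add: cycle_rep_eq_iff)
    then show ?thesis using True f fin by (simp add: dihedral_restr_def cycle_rep_of_nat)
  next
    case False
    then show ?thesis using dom by (auto simp: dihedral_restr_def)
  qed
  moreover have "c \<in> {0..<int n}" using n by (simp add: c_def)
  ultimately show ?thesis using s that by blast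
qed

lemma isometries_on_eq:
  assumes "n \<ge> 3" "A \<subseteq> {1..n}" "A \<noteq> {}"
  shows "isometries_on n A = dihedral_restr n A ` ({0..<int n} \<times> {1, -1})"
proof
  obtain a where "a \<in> A" using assms(3) by blast
  show "isometries_on n A \<subseteq> dihedral_restr n A ` ({0..<int n} \<times> {1, -1})"
  proof
    fix \<alpha> assume "\<alpha> \<in> isometries_on n A"
    from isometry_is_dihedral_restr[OF assms(1) \<open>a \<in> A\<close> this]
    obtain c s where "c \<in> {0..<int n}" "s = 1 \<or> s = -1" "\<alpha> = dihedral_restr n A (c, s)" .
    then show "\<alpha> \<in> dihedral_restr n A ` ({0..<int n} \<times> {1, -1})" by blast
  qed
  show "dihedral_restr n A ` ({0..<int n} \<times> {1, -1}) \<subseteq> isometries_on n A"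
    using assms dihedral_restr_isometry by auto
qed

section \<open>Number of isometries with a given domain\<close>

lemma dihedral_restr_eq_iff:
  assumes "n > 0"
  shows "dihedral_restr n A (c, s) = dihedral_restr n A (c', s')
    \<longleftrightarrow> (\<forall>x\<in>A. int n dvd (c + s * int x) - (c' + s' * int x))"
  using assms by (auto simp: dihedral_restr_def fun_eq_iff cycle_rep_eq_iff)

lemma dvd_diff_residues_eq:
  assumes "int n dvd c - c'" "c \<in> {0..<int n}" "c' \<in> {0..<int n}"
  shows "c = c'"
  using dvd_abs_less[OF assms(1)] assms(2,3) by auto

lemma card_isometries_on_degenerate:
  assumes n: "n \<ge> 3" and A: "A \<subseteq> {1..n}" "A \<noteq> {}" and deg: "degenerate n A"
  shows "card (isometries_on n A) = n"
proof -
  obtain a where a: "a \<in> A" using A by blast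
  have np: "n > 0" using n by simp
  have "dihedral_restr n A (c, -1) \<in> dihedral_restr n A ` ({0..<int n} \<times> {1})" for c
  proof -
    \<comment> \<open>The rotation by c - 2a agrees with the reflection at a; degeneracy extends the
      agreement to all of \<open>A\<close>.\<close>
    define c' where "c' = (c - 2 * int a) mod int n"
    have c': "int n dvd (c - 2 * int a) - c'"
      by (simp add: c'_def minus_mod_eq_mult_div)
    have "int n dvd (c + (-1) * int x) - (c' + 1 * int x)" if "x \<in> A" for x
    proof -
      have "int n dvd 2 * (int x - int a)" using deg that a by (auto simp: degenerate_def)
      from dvd_diff[OF c' this] show ?thesis by (simp add: algebra_simps)
    qed
    then have "dihedral_restr n A (c, -1) = dihedral_restr n A (c', 1)"
      using dihedral_restr_eq_iff[OF np] by blast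
    moreover have "c' \<in> {0..<int n}" using np by (simp add: c'_def)
    ultimately show ?thesis by blast
  qed
  then have "isometries_on n A = dihedral_restr n A ` ({0..<int n} \<times> {1})"
    unfolding isometries_on_eq[OF n A] by blast
  \<comment> \<open>Distinct rotations already differ at the single point a.\<close>
  moreover have "inj_on (dihedral_restr n A) ({0..<int n} \<times> {1})"
    using a dvd_diff_residues_eq by (fastforce simp: inj_on_def dihedral_restr_eq_iff[OF np])
  ultimately show ?thesis by (simp add: card_image card_cartesian_product)
qed

lemma card_isometries_on_nondegenerate:
  assumes n: "n \<ge> 3" and A: "A \<subseteq> {1..n}" and nd: "\<not> degenerate n A"
  shows "card (isometries_on n A) = 2 * n"
proof -
  have np: "n > 0" using n by simp
  obtain a b where ab: "a \<in> A" "b \<in> A" "\<not> int n dvd 2 * (int a - int b)"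
    using nd by (auto simp: degenerate_def)
  have "inj_on (dihedral_restr n A) ({0..<int n} \<times> {1, -1})"
  proof (rule inj_onI)
    fix p q assume p: "p \<in> {0..<int n} \<times> {1, -1 :: int}" and q: "q \<in> {0..<int n} \<times> {1, -1 :: int}"
      and eq: "dihedral_restr n A p = dihedral_restr n A q"
    obtain c s where ps: "p = (c, s)" by (cases p)
    obtain c' s' where qs: "q = (c', s')" by (cases q)
    have d: "int n dvd (c + s * int x) - (c' + s' * int x)" if "x \<in> A" for x
      using eq that by (simp add: ps qs dihedral_restr_eq_iff[OF np])
    \<comment> \<open>Subtracting the congruences at a and b cancels the translation parts; distinct
      signs would then leave 2(a - b) divisible by n.\<close>
    have d2: "int n dvd (s - s') * (int a - int b)"
      using dvd_diff[OF d[OF ab(1)] d[OF ab(2)]] by (simp add: algebra_simps)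
    have "s = s'"
    proof (rule ccontr)
      assume "s \<noteq> s'"
      then have "s - s' = 2 \<or> s - s' = -2" using p q by (auto simp: ps qs)
      then show False
      proof
        assume "s - s' = -2"
        with d2 have "int n dvd - (2 * (int a - int b))" by simp
        with ab(3) show False by (simp only: dvd_minus_iff)
      qed (use d2 ab(3) in simp)
    qed
    with d[OF ab(1)] have "int n dvd c - c'" by simp
    with dvd_diff_residues_eq p q \<open>s = s'\<close> show "p = q" by (auto simp: ps qs)
  qed
  moreover have "A \<noteq> {}" using ab by blast
  ultimately show ?thesis
    using isometries_on_eq[OF n A] by (simp add: card_image card_cartesian_product)
qed

text \<open>The empty set satisfies \<open>degenerate\<close> vacuously but carries one isometry
  instead of n, so it is counted separately.\<close>

lemma isometries_on_empty: "isometries_on n {} = {Map.empty}"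
  by (auto simp: isometries_on_def partial_isometry_def)

section \<open>Number of degenerate domains\<close>

definition degenerate_sets :: "nat \<Rightarrow> nat set set" where
  "degenerate_sets n = {A. A \<subseteq> {1..n} \<and> A \<noteq> {} \<and> degenerate n A}"

text \<open>Twice a difference of points of \<open>{1..n}\<close> has modulus below 2n, so it is a
  multiple of n only if it is 0 or n up to sign.\<close>

lemma degenerate_iff_antipodal:
  assumes "A \<subseteq> {1..n}"
  shows "degenerate n A \<longleftrightarrow> (\<forall>x\<in>A. \<forall>y\<in>A. x < y \<longrightarrow> 2 * (y - x) = n)"
proof -
  have "int n dvd 2 * (int x - int y) \<longleftrightarrow>
      (x < y \<longrightarrow> 2 * (y - x) = n) \<and> (y < x \<longrightarrow> 2 * (x - y) = n)" if "x \<in> A" "y \<in> A" for x y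
  proof -
    have "x \<in> {1..n}" "y \<in> {1..n}" using that assms by auto
    then have "\<bar>2 * (int x - int y)\<bar> < 2 * int n" by simp linarith
    then have "int n dvd 2 * (int x - int y) \<longleftrightarrow>
        2 * (int x - int y) \<in> {0, int n, - int n}"
      using dvd_abs_less[of n "2 * (int x - int y)"] by fastforce
    also have "\<dots> \<longleftrightarrow> (x < y \<longrightarrow> 2 * (y - x) = n) \<and> (y < x \<longrightarrow> 2 * (x - y) = n)"
      using that assms by auto
    finally show ?thesis .
  qed
  then show ?thesis unfolding degenerate_def by blast
qed

text \<open>An odd cycle has no antipodal points, which leaves the singletons.\<close>

lemma card_degenerate_sets_odd:
  assumes "odd n"
  shows "card (degenerate_sets n) = n"
proof -
  have "degenerate_sets n = (\<lambda>x. {x}) ` {1..n}"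
  proof (intro Set.set_eqI iffI)
    fix A assume "A \<in> degenerate_sets n"
    then have A: "A \<subseteq> {1..n}" "A \<noteq> {}" "\<forall>x\<in>A. \<forall>y\<in>A. x < y \<longrightarrow> 2 * (y - x) = n"
      using degenerate_iff_antipodal by (auto simp: degenerate_sets_def)
    obtain a where a: "a \<in> A" using A by blast
    have "x = a" if "x \<in> A" for x
      using A(3) a that assms by (metis dvd_triv_left linorder_neqE_nat)
    with a A(1) show "A \<in> (\<lambda>x. {x}) ` {1..n}" by blast
  next
    fix A assume "A \<in> (\<lambda>x. {x}) ` {1..n}"
    then show "A \<in> degenerate_sets n" by (auto simp: degenerate_sets_def degenerate_def)
  qed
  then show ?thesis by (simp add: card_image)
qed

text \<open>There are 2m singletons, and m antipodal pairs, each indexed by its smaller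
  element.\<close>

lemma card_degenerate_sets_even:
  assumes m: "m > 0"
  shows "card (degenerate_sets (2 * m)) = 3 * m"
proof -
  let ?S = "(\<lambda>x. {x}) ` {1..2 * m}" and ?P = "(\<lambda>x. {x, x + m}) ` {1..m}"
  have "degenerate_sets (2 * m) = ?S \<union> ?P"
  proof (intro Set.set_eqI iffI)
    fix A assume "A \<in> degenerate_sets (2 * m)"
    then have A: "A \<subseteq> {1..2 * m}" "A \<noteq> {}" "\<forall>x\<in>A. \<forall>y\<in>A. x < y \<longrightarrow> 2 * (y - x) = 2 * m"
      using degenerate_iff_antipodal by (auto simp: degenerate_sets_def)
    \<comment> \<open>Any element other than the least one lies above it, hence at a + m; so
      \<open>A\<close> has at most two elements.\<close>
    define a where "a = (LEAST x. x \<in> A)"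
    have a: "a \<in> A" using A(2) unfolding a_def by (meson LeastI ex_in_conv)
    have x: "x = a \<or> x = a + m" if "x \<in> A" for x
      using Least_le[of "\<lambda>x. x \<in> A" x] that A(3) a by (force simp: a_def[symmetric] le_less)
    show "A \<in> ?S \<union> ?P"
    proof (cases "a + m \<in> A")
      case True
      then have "A = {a, a + m}" using a x by blast
      moreover have "a \<in> {1..m}" using True a A(1) by auto
      ultimately show ?thesis by blast
    next
      case False
      then have "A = {a}" using a x by blast
      with A(1) show ?thesis by blast
    qed
  next
    fix A assume "A \<in> ?S \<union> ?P"
    then show "A \<in> degenerate_sets (2 * m)"
      by (auto simp: degenerate_sets_def degenerate_def)
  qed
  moreover have "?S \<inter> ?P = {}" using m by auto
  moreover have "card ?S = 2 * m" by (simp add: card_image)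
  moreover have "card ?P = m"
    by (subst card_image) (auto simp: inj_on_def doubleton_eq_iff)
  ultimately show ?thesis by (simp add: card_Un_disjoint)
qed

section \<open>Summation over all domains\<close>

text \<open>Counting 2n isometries for each of the 2^n - 1 nonempty domains gives n too many for
  each degenerate one; the empty map adds 1. The additive form avoids truncated subtraction.\<close>

lemma order_DPC:
  assumes n: "n \<ge> 3"
  shows "order (DPC n) + n * card (degenerate_sets n) + 2 * n = 2 * n * 2 ^ n + 1"
proof -
  let ?U = "Pow {1..n} - {{}}"
  let ?D = "degenerate_sets n"
  have D: "?D \<subseteq> ?U" by (auto simp: degenerate_sets_def)
  have fin: "finite (isometries_on n A)" if "A \<subseteq> {1..n}" for A
    using isometries_on_eq[OF n that] isometries_on_empty[of n] by (cases "A = {}") auto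
  have "carrier (DPC n) = (\<Union>A\<in>Pow {1..n}. isometries_on n A)"
    by (auto simp: DPC_def isometries_on_def partial_isometry_def)
  then have "order (DPC n) = (\<Sum>A\<in>Pow {1..n}. card (isometries_on n A))"
    unfolding order_def using fin
    by (simp only:) (subst card_UN_disjoint, auto simp: isometries_on_def)
  also have "\<dots> = card (isometries_on n {}) + (\<Sum>A\<in>?U. card (isometries_on n A))"
    by (subst sum.remove[of _ "{}"]) auto
  also have "(\<Sum>A\<in>?U. card (isometries_on n A))
      = (\<Sum>A\<in>?U - ?D. card (isometries_on n A)) + (\<Sum>A\<in>?D. card (isometries_on n A))"
    using D by (intro sum.subset_diff) auto
  also have "(\<Sum>A\<in>?D. card (isometries_on n A)) = (\<Sum>A\<in>?D. n)"
    using card_isometries_on_degenerate[OF n] by (intro sum.cong) (auto simp: degenerate_sets_def)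
  also have "(\<Sum>A\<in>?U - ?D. card (isometries_on n A)) = (\<Sum>A\<in>?U - ?D. 2 * n)"
    using card_isometries_on_nondegenerate[OF n]
    by (intro sum.cong) (auto simp: degenerate_sets_def)
  finally have o: "order (DPC n) = 1 + (2 * n * card (?U - ?D) + n * card ?D)"
    by (simp add: isometries_on_empty mult.commute)
  have "card ?U + 1 = 2 ^ n" by (simp add: card_Diff_subset card_Pow)
  moreover have "card ?U = card (?U - ?D) + card ?D"
    using D by (metis card_Diff_subset card_mono finite_Diff finite_Pow_iff finite_atLeastAtMost
      finite_subset le_add_diff_inverse2)
  ultimately have "2 * n * 2 ^ n = 2 * n * (card (?U - ?D) + card ?D + 1)" by simp
  with o show ?thesis by (simp add: algebra_simps)
qed

theorem theorem1p4:
  fixes n :: nat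
  assumes "n \<ge> 3"
  shows "real (order (DPC n))
    = real n * 2 ^ (n + 1) - ((-1) ^ n + 5) / 4 * (real n)\<^sup>2 - 2 * real n + 1"
proof -
  have "real (order (DPC n) + n * card (degenerate_sets n) + 2 * n) = real (2 * n * 2 ^ n + 1)"
    using order_DPC[OF assms] by simp
  then have o: "real (order (DPC n))
      = real n * 2 ^ (n + 1) - real n * real (card (degenerate_sets n)) - 2 * real n + 1"
    by simp
  \<comment> \<open>The factor ((-1)^n + 5)/4 is 1 for odd n and 3/2 for even n, matching n and 3n/2
    degenerate domains.\<close>
  have "real n * real (card (degenerate_sets n)) = ((-1) ^ n + 5) / 4 * (real n)\<^sup>2"
  proof (cases "even n")
    case True
    then obtain m where "n = 2 * m" by blast
    with assms show ?thesis by (simp add: card_degenerate_sets_even power2_eq_square)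
  next
    case False
    then show ?thesis by (simp add: card_degenerate_sets_odd power2_eq_square)
  qed
  with o show ?thesis by simp
qed

end
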